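(* Consider an instance of the $k$-adaptability problem with second-stage dimension $n$, belonging to a problem class with second-stage cardinality bounds $\underline p,\bar p$ (with $\underline p(n)>0$) and with cost bounds $0<m_\infty\le M_\infty$, where $d\ge0$ and $d^\top x\ge0$ for all $x\in X$. Let $k\in\mathbb N$ with $k\le n$, and let $\underline u,\bar u\in\mathbb R_+^n$ with $\underline u_j>0$ for all $j$ be such that $U\subseteq[\underline u,\bar u]$. Then the solution $\hat x,\bar y^1,\dots,\bar y^k$ returned by the scenario-based $k$-adaptability algorithm (Algorithm 2, described in the context, with any $t\ge k$) satisfies $$\mathrm{approx}_{\mathrm{adapt}}(k)\le\alpha\left(1+\tilde M(n)\,\frac{n-k}{k+1}\right)\mathrm{adapt}(k),$$ where $\alpha=\max_{j=1,\dots,n}\frac{\bar u_j}{\underline u_j}$ and $\tilde M(n)=\frac{M_\infty}{m_\infty}\frac{\bar p(n)}{\underline p(n)}$.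
   Context: Notation: $\mathbb N=\{1,2,\dots\}$, $[k]=\{1,\dots,k\}$, $\mathbb R_+^n=\{y\in\mathbb R^n:y\ge0\}$, $[\underline u,\bar u]=\{\xi:\underline u\le\xi\le\bar u\}$ componentwise, and $\|y\|_0$ is the number of non-zero entries of $y$. An instance consists of a nonempty first-stage set $X\subseteq\mathbb R^m$, nonempty second-stage sets $Y(x)\subseteq\{0,1\}^n$ for $x\in X$, a nonempty convex uncertainty set $U\subseteq\mathbb R_+^n$ and first-stage costs $d\in\mathbb R_+^m$; all minima and maxima written are understood to be attained. For $k\in\mathbb N$ the $k$-adaptability problem is $$\min_{x\in X,\ y^1,\dots,y^k\in Y(x)}\ \max_{\xi\in U}\ \min_{i=1,\dots,k}\ d^\top x+\xi^\top y^i,$$ with optimal value $\mathrm{adapt}(k)$. A problem class has second-stage cardinality bounds $\underline p,\bar p:\mathbb N\to\mathbb R_+$ if for every instance with $n$ second-stage variables $\underline p(n)\le\|y\|_0\le\bar p(n)$ for all $x\in X$ and $y\in Y(x)$. Cost bounds $0<m_\infty\le M_\infty$ means that $m_\infty\le\xi_j\le M_\infty$ for all $\xi\in U$ and $j\in[n]$. Algorithm 1 (min-max-min, applied to a set $Z\subseteq\{0,1\}^n$, $U$ and $k\in[n]$): (1) compute an optimal solution $z^1,\dots,z^n$ of $\min_{z^1,\dots,z^n\in Z}\max_{\xi\in U}\min_{i=1,\dots,n}\xi^\top z^i$; (2) compute an optimal solution $\lambda^*$ of $\min\{\max_{\xi\in U}\xi^\top z: z=\sum_{i=1}^n\lambda_iz^i,\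 \sum_{i=1}^n\lambda_i=1,\ \lambda\ge0\}$; (3) sort $\lambda^*_{i_1}\ge\dots\ge\lambda^*_{i_n}$; (4) return $z^{i_1},\dots,z^{i_k}$. Algorithm 2 (input $n$, $k\in[n]$, $t\ge k$, $U\subseteq[\underline u,\bar u]$): (1) select arbitrary $\hat\xi^1,\dots,\hat\xi^t\in U$; (2) compute an optimal solution $(\hat x,\hat y^1,\dots,\hat y^t)$ of $\min\{d^\top x+\mu:\ \mu\ge(y^i)^\top\hat\xi^i\ (i=1,\dots,t),\ x\in X,\ y^1,\dots,y^t\in Y(x)\}$; (3) compute $\bar y^1,\dots,\bar y^k\in Y(\hat x)$ by Algorithm 1 applied to the min-max-min problem $d^\top\hat x+\min_{y^1,\dots,y^k\in Y(\hat x)}\max_{\xi\in U}\min_{i=1,\dots,k}\xi^\top y^i$ (i.e. with $Z=Y(\hat x)$); (4) return $\hat x,\bar y^1,\dots,\bar y^k$. The objective value of the returned solution is $$\mathrm{approx}_{\mathrm{adapt}}(k):=d^\top\hat x+\max_{\xi\in U}\min_{i=1,\dots,k}\xi^\top\bar y^i.$$ *)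

theory Defs
  imports "Jordan_Normal_Form.Matrix" "HOL-Library.FuncSet" Complex_Main
begin

definition nonneg_vecs :: "nat \<Rightarrow> real vec set" where
  "nonneg_vecs n = {y \<in> carrier_vec n. 0\<^sub>v n \<le> y}"

definition binary_vecs :: "nat \<Rightarrow> real vec set" where
  "binary_vecs n = {y \<in> carrier_vec n. \<forall>j<n. y $ j \<in> {0, 1}}"

definition nonzero_count :: "real vec \<Rightarrow> nat" where
  "nonzero_count y = card {j. j < dim_vec y \<and> y $ j \<noteq> 0}"

text \<open>The type \<open>real vec\<close> contains vectors of all dimensions, so it is no vector space type and the
  library's \<open>convex\<close> does not apply to it.\<close>

definition convex_vecs :: "real vec set \<Rightarrow> bool" where
  "convex_vecs U \<longleftrightarrow>
     (\<forall>\<xi>\<in>U. \<forall>\<zeta>\<in>U. \<forall>s\<in>{0..1}. s \<cdot>\<^sub>v \<xi> + (1 - s) \<cdot>\<^sub>v \<zeta> \<in> U)"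

record kadapt_instance =
  dim1 :: nat
  dim2 :: nat
  first_stage :: "real vec set"
  second_stage :: "real vec \<Rightarrow> real vec set"
  uncertainty :: "real vec set"
  first_cost :: "real vec"

definition valid_instance :: "kadapt_instance \<Rightarrow> bool" where
  "valid_instance I \<longleftrightarrow>
     1 \<le> dim1 I \<and> 1 \<le> dim2 I \<and>
     first_stage I \<noteq> {} \<and> first_stage I \<subseteq> carrier_vec (dim1 I) \<and>
     (\<forall>x\<in>first_stage I. second_stage I x \<noteq> {} \<and> second_stage I x \<subseteq> binary_vecs (dim2 I)) \<and>
     uncertainty I \<noteq> {} \<and> uncertainty I \<subseteq> nonneg_vecs (dim2 I) \<and> convex_vecs (uncertainty I) \<and>
     first_cost I \<in> nonneg_vecs (dim1 I)"

text \<open>Tuples \<open>y\<^sup>1, \<dots>, y\<^sup>k\<close> are functions on indices of which only the values on \<open>{1..k}\<close>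
  matter, whereas vector components are indexed from \<open>0\<close>. Maxima and minima of reals over possibly
  infinite sets are written as \<open>SUP\<close> and \<open>INF\<close>; that they are attained is a separate
  condition, \<open>extrema_attained\<close> below.\<close>

definition feasible :: "kadapt_instance \<Rightarrow> nat \<Rightarrow> (real vec \<times> (nat \<Rightarrow> real vec)) set" where
  "feasible I k = {(x, y). x \<in> first_stage I \<and> y \<in> {1..k} \<rightarrow> second_stage I x}"

definition worst_case_cost :: "kadapt_instance \<Rightarrow> nat \<Rightarrow> real vec \<times> (nat \<Rightarrow> real vec) \<Rightarrow> real" where
  "worst_case_cost I k = (\<lambda>(x, y).
     SUP \<xi>\<in>uncertainty I. MIN i\<in>{1..k}. first_cost I \<bullet> x + \<xi> \<bullet> y i)"

definition adapt :: "kadapt_instance \<Rightarrow> nat \<Rightarrow> real" where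
  "adapt I k = (INF p\<in>feasible I k. worst_case_cost I k p)"

definition max_min_value :: "real vec set \<Rightarrow> nat \<Rightarrow> (nat \<Rightarrow> real vec) \<Rightarrow> real" where
  "max_min_value U q z = (SUP \<xi>\<in>U. MIN i\<in>{1..q}. \<xi> \<bullet> z i)"

definition convex_weights :: "nat \<Rightarrow> (nat \<Rightarrow> real) set" where
  "convex_weights q = {l. (\<forall>i\<in>{1..q}. 0 \<le> l i) \<and> (\<Sum>i\<in>{1..q}. l i) = 1}"

definition weighted_sum :: "nat \<Rightarrow> nat \<Rightarrow> (nat \<Rightarrow> real) \<Rightarrow> (nat \<Rightarrow> real vec) \<Rightarrow> real vec" where
  "weighted_sum n q l z = finsum_vec TYPE(real) n (\<lambda>i. l i \<cdot>\<^sub>v z i) {1..q}"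

text \<open>The min-max-min algorithm as a relation: \<open>w\<^sup>1, \<dots>, w\<^sup>k\<close> is a possible output for some
  choice of the two optimal solutions and some way of breaking ties in the sorting step. In the second
  step the vector \<open>z\<close> is eliminated, since the weights determine it.\<close>

definition min_max_min_output ::
  "nat \<Rightarrow> real vec set \<Rightarrow> real vec set \<Rightarrow> nat \<Rightarrow> (nat \<Rightarrow> real vec) \<Rightarrow> bool" where
  "min_max_min_output n Z U k w \<longleftrightarrow> (\<exists>z l \<sigma>.
     is_arg_min (max_min_value U n) (\<lambda>z. z \<in> {1..n} \<rightarrow> Z) z \<and>
     is_arg_min (\<lambda>l. SUP \<xi>\<in>U. \<xi> \<bullet> weighted_sum n n l z) (\<lambda>l. l \<in> convex_weights n) l \<and>
     bij_betw \<sigma> {1..n} {1..n} \<and>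
     (\<forall>a\<in>{1..n}. \<forall>b\<in>{1..n}. a \<le> b \<longrightarrow> l (\<sigma> b) \<le> l (\<sigma> a)) \<and>
     (\<forall>i\<in>{1..k}. w i = z (\<sigma> i)))"

definition scenario_feasible ::
  "kadapt_instance \<Rightarrow> nat \<Rightarrow> (nat \<Rightarrow> real vec) \<Rightarrow> (real vec \<times> (nat \<Rightarrow> real vec) \<times> real) set" where
  "scenario_feasible I t \<xi>s =
     {(x, y, \<mu>). x \<in> first_stage I \<and> y \<in> {1..t} \<rightarrow> second_stage I x \<and>
                 (\<forall>i\<in>{1..t}. y i \<bullet> \<xi>s i \<le> \<mu>)}"

definition scenario_algorithm_output ::
  "kadapt_instance \<Rightarrow> nat \<Rightarrow> nat \<Rightarrow> real vec \<Rightarrow> (nat \<Rightarrow> real vec) \<Rightarrow> bool" where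
  "scenario_algorithm_output I k t xh yb \<longleftrightarrow> (\<exists>\<xi>s yh \<mu>h.
     \<xi>s \<in> {1..t} \<rightarrow> uncertainty I \<and>
     is_arg_min (\<lambda>(x, y, \<mu>). first_cost I \<bullet> x + \<mu>) (\<lambda>s. s \<in> scenario_feasible I t \<xi>s) (xh, yh, \<mu>h) \<and>
     min_max_min_output (dim2 I) (second_stage I xh) (uncertainty I) k yb)"

definition approx_adapt :: "kadapt_instance \<Rightarrow> nat \<Rightarrow> real vec \<Rightarrow> (nat \<Rightarrow> real vec) \<Rightarrow> real" where
  "approx_adapt I k xh yb = first_cost I \<bullet> xh + max_min_value (uncertainty I) k yb"

text \<open>All extrema in the \<open>k\<close>-adaptability problem and all inner maxima in the algorithms are
  attained. The minima in the algorithms are attained by the optimal solutions that every output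
  presupposes.\<close>

definition extrema_attained :: "kadapt_instance \<Rightarrow> nat \<Rightarrow> bool" where
  "extrema_attained I k \<longleftrightarrow>
     (\<exists>p. is_arg_min (worst_case_cost I k) (\<lambda>p. p \<in> feasible I k) p) \<and>
     (\<forall>(x, y)\<in>feasible I k.
        \<exists>\<xi>. is_arg_max (\<lambda>\<xi>. MIN i\<in>{1..k}. first_cost I \<bullet> x + \<xi> \<bullet> y i) (\<lambda>\<xi>. \<xi> \<in> uncertainty I) \<xi>) \<and>
     (\<forall>x\<in>first_stage I. \<forall>z\<in>{1..dim2 I} \<rightarrow> second_stage I x.
        (\<exists>\<xi>. is_arg_max (\<lambda>\<xi>. MIN i\<in>{1..dim2 I}. \<xi> \<bullet> z i) (\<lambda>\<xi>. \<xi> \<in> uncertainty I) \<xi>) \<and>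
        (\<forall>l\<in>convex_weights (dim2 I).
           \<exists>\<xi>. is_arg_max (\<lambda>\<xi>. \<xi> \<bullet> weighted_sum (dim2 I) (dim2 I) l z) (\<lambda>\<xi>. \<xi> \<in> uncertainty I) \<xi>))"

definition problem_class :: "kadapt_instance set \<Rightarrow> bool" where
  "problem_class \<C> \<longleftrightarrow> (\<forall>I\<in>\<C>. valid_instance I)"

definition cardinality_bounds ::
  "kadapt_instance set \<Rightarrow> (nat \<Rightarrow> real) \<Rightarrow> (nat \<Rightarrow> real) \<Rightarrow> bool" where
  "cardinality_bounds \<C> pl pu \<longleftrightarrow>
     (\<forall>n\<ge>1. 0 \<le> pl n \<and> 0 \<le> pu n) \<and>
     (\<forall>I\<in>\<C>. \<forall>x\<in>first_stage I. \<forall>y\<in>second_stage I x.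
        pl (dim2 I) \<le> real (nonzero_count y) \<and> real (nonzero_count y) \<le> pu (dim2 I))"

definition cost_bounds :: "kadapt_instance \<Rightarrow> real \<Rightarrow> real \<Rightarrow> bool" where
  "cost_bounds I m M \<longleftrightarrow>
     0 < m \<and> m \<le> M \<and> (\<forall>\<xi>\<in>uncertainty I. \<forall>j<dim2 I. m \<le> \<xi> $ j \<and> \<xi> $ j \<le> M)"

end

theory Submission
  imports Defs
begin

text \<open>The scenario problem relaxes \<open>k\<close>-adaptability, so its optimal value is at most \<open>adapt k\<close>, and
  by \<open>U \<subseteq> [ul, uu]\<close> the worst case of a single scenario solution exceeds its scenario cost by at
  most the factor \<open>\<alpha>\<close>; hence the min-max-min value with \<open>n\<close> solutions is at most \<open>\<alpha>\<close> times the
  scenario value. By minimax duality the optimal weights \<open>l\<close> of the min-max-min algorithm certify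
  this value as a bound on the weighted average of the costs, for every scenario. Dropping the
  \<open>n - k\<close> solutions of smallest weight costs little, because each of their weights is at most
  \<open>1 / (k + 1)\<close> and any two second-stage costs differ by at most \<open>Mt\<close> times that value.\<close>

section \<open>A minimax theorem for convexlike families\<close>

text \<open>The pairs \<open>(f a, g a)\<close> form a convex set in the plane that misses the open
  positive quadrant, and \<open>(t, 1 - t)\<close> is the normal of a separating line. Each point
  with \<open>0 < g b\<close> bounds \<open>t\<close> from below and each point with
  \<open>0 < f a\<close> bounds it from above; the supremum of the lower bounds respects every upper
  bound.\<close>

lemma convexlike_alternative_two:
  fixes f g :: "'a \<Rightarrow> real"
  assumes mix: "\<And>a b s. \<lbrakk>a \<in> U; b \<in> U; 0 \<le> s; s \<le> 1\<rbrakk> \<Longrightarrow>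
      \<exists>c\<in>U. f c = s * f a + (1 - s) * f b \<and> g c = s * g a + (1 - s) * g b"
    and alt: "\<And>a. a \<in> U \<Longrightarrow> f a \<le> 0 \<or> g a \<le> 0"
  shows "\<exists>t. 0 \<le> t \<and> t \<le> 1 \<and> (\<forall>a\<in>U. t * f a + (1 - t) * g a \<le> 0)"
proof (cases "\<exists>b\<in>U. 0 < g b")
  case False
  then show ?thesis by (intro exI[of _ 0]) (auto simp: not_less)
next
  case True
  \<comment> \<open>If \<open>0 < g b\<close>, hence \<open>f b\<close> is nonpositive, then
    \<open>r b\<close> is the least \<open>t\<close> with
    \<open>t * f b + (1 - t) * g b \<le> 0\<close>.\<close>
  define r where "r = (\<lambda>b. g b / (g b - f b))"
  define B where "B = {b \<in> U. 0 < g b}"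
  have B_ne: "B \<noteq> {}" using True by (auto simp: B_def)
  have fB: "f b \<le> 0" if "b \<in> B" for b using that alt[of b] by (auto simp: B_def)
  have r01: "0 \<le> r b \<and> r b \<le> 1" if "b \<in> B" for b
    using that fB[OF that] by (auto simp: r_def B_def divide_simps)
  have bdd: "bdd_above (r ` B)" using r01 by (auto intro!: bdd_aboveI[of _ 1])
  define t where "t = (SUP b\<in>B. r b)"
  have t_ge: "r b \<le> t" if "b \<in> B" for b
    unfolding t_def using bdd that by (rule cSUP_upper2) simp
  have t0: "0 \<le> t" using B_ne t_ge r01 by (meson all_not_in_conv order_trans)
  have t1: "t \<le> 1" unfolding t_def using B_ne r01 by (auto intro!: cSUP_least)
  \<comment> \<open>After clearing denominators, this says that the lower bound from
    \<open>b\<close> does not exceed the upper bound \<open>- g a / (f a - g a)\<close> from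
    \<open>a\<close>.\<close>
  have sep: "g b * f a \<le> g a * f b" if a: "a \<in> U" "0 < f a" and b: "b \<in> B" for a b
  proof (rule ccontr)
    assume "\<not> ?thesis"
    then have lt: "g a * f b < g b * f a" by simp
    have ga: "g a \<le> 0" using alt[of a] a by auto
    have gb: "0 < g b" "b \<in> U" using b by (auto simp: B_def)
    define w where "w = f a - f b + (g b - g a)"
    have w: "0 < w" using a ga gb fB[OF b] by (simp add: w_def)
    \<comment> \<open>This is the mixture of \<open>a\<close> and \<open>b\<close> that lands on the
      diagonal, where \<open>f c = g c\<close>. If \<open>sep\<close> failed, this common value
      would be positive.\<close>
    define s where "s = (g b - f b) / w"
    have s: "0 \<le> s" "s \<le> 1" using w ga gb a fB[OF b] by (auto simp: s_def w_def divide_simps)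
    have s': "1 - s = (f a - g a) / w" using w by (simp add: s_def w_def field_simps)
    obtain c where c: "c \<in> U" "f c = s * f a + (1 - s) * f b" "g c = s * g a + (1 - s) * g b"
      using mix[OF a(1) gb(2) s] by blast
    have "f c = (g b * f a - g a * f b) / w" "g c = (g b * f a - g a * f b) / w"
      unfolding c s' unfolding s_def using w by (simp_all add: field_simps)
    then have "0 < f c" "0 < g c" using lt w by auto
    with alt[OF c(1)] show False by auto
  qed
  have "t * f a + (1 - t) * g a \<le> 0" if a: "a \<in> U" for a
  proof (cases "0 < f a")
    case True
    have ga: "g a \<le> 0" using alt[of a] a True by auto
    have "r b \<le> - g a / (f a - g a)" if b: "b \<in> B" for b
    proof -
      have "g b * (f a - g a) \<le> - g a * (g b - f b)"
        using sep[OF a True b] by (simp add: algebra_simps)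
      then show ?thesis
        using True ga b fB[OF b] by (simp add: r_def B_def divide_simps mult.commute)
    qed
    then have "t \<le> - g a / (f a - g a)" unfolding t_def using B_ne by (intro cSUP_least)
    moreover have "0 < f a - g a" using True ga by simp
    ultimately have "t * (f a - g a) \<le> - g a" by (simp only: pos_le_divide_eq)
    then show ?thesis by (simp add: algebra_simps)
  next
    case f: False
    show ?thesis
    proof (cases "0 < g a")
      case True
      then have aB: "a \<in> B" using a by (simp add: B_def)
      have "g a / (g a - f a) \<le> t" using t_ge[OF aB] by (simp add: r_def)
      then have "g a \<le> t * (g a - f a)" using True f by (simp add: pos_divide_le_eq)
      then show ?thesis by (simp add: algebra_simps)
    next
      case False
      then show ?thesis using f t0 t1
        by (intro add_nonpos_nonpos mult_nonneg_nonpos) auto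
    qed
  qed
  with t0 t1 show ?thesis by blast
qed

text \<open>Induction on the index set, with \<open>U\<close> left arbitrary so that the hypothesis
  can be used on a smaller domain. The hypothesis merges the functions of \<open>J\<close> into a
  single one, and the case of two functions then adds \<open>f j\<close>.\<close>

lemma convexlike_alternative:
  fixes f :: "'i \<Rightarrow> 'a \<Rightarrow> real"
  assumes "finite I" "I \<noteq> {}"
    and "\<And>a b s. \<lbrakk>a \<in> U; b \<in> U; 0 \<le> s; s \<le> 1\<rbrakk> \<Longrightarrow>
      \<exists>c\<in>U. \<forall>i\<in>I. f i c = s * f i a + (1 - s) * f i b"
    and "\<And>a. a \<in> U \<Longrightarrow> \<exists>i\<in>I. f i a \<le> 0"
  shows "\<exists>l. (\<forall>i\<in>I. 0 \<le> l i) \<and> sum l I = 1 \<and> (\<forall>a\<in>U. (\<Sum>i\<in>I. l i * f i a) \<le> 0)"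
  using assms
proof (induction I arbitrary: U rule: finite_ne_induct)
  case (singleton j)
  then show ?case by (intro exI[of _ "\<lambda>_. 1"]) auto
next
  case (insert j J)
  \<comment> \<open>Where \<open>f j\<close> is positive, some function with index in
    \<open>J\<close> must be nonpositive. Mixing preserves \<open>0 < f j\<close>, so the induction
    hypothesis applies to \<open>V\<close>, even if \<open>V\<close> is empty.\<close>
  define V where "V = {a \<in> U. 0 < f j a}"
  have "\<exists>l. (\<forall>i\<in>J. 0 \<le> l i) \<and> sum l J = 1 \<and> (\<forall>a\<in>V. (\<Sum>i\<in>J. l i * f i a) \<le> 0)"
  proof (rule insert.IH)
    fix a b and s :: real
    assume ab: "a \<in> V" "b \<in> V" and s: "0 \<le> s" "s \<le> 1"
    then obtain c where c: "c \<in> U" "\<forall>i\<in>insert j J. f i c = s * f i a + (1 - s) * f i b"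
      using insert.prems(1)[of a b s] by (auto simp: V_def)
    have "0 < s * f j a + (1 - s) * f j b"
    proof (cases "s = 0")
      case False
      then show ?thesis using ab s
        by (intro add_pos_nonneg) (auto simp: V_def)
    qed (use ab in \<open>simp add: V_def\<close>)
    then show "\<exists>c\<in>V. \<forall>i\<in>J. f i c = s * f i a + (1 - s) * f i b"
      using c by (intro bexI[of _ c]) (auto simp: V_def)
  next
    fix a assume "a \<in> V"
    then show "\<exists>i\<in>J. f i a \<le> 0" using insert.prems(2)[of a] by (auto simp: V_def)
  qed
  then obtain l where l: "\<forall>i\<in>J. 0 \<le> l i" "sum l J = 1" "\<forall>a\<in>V. (\<Sum>i\<in>J. l i * f i a) \<le> 0"
    by blast
  define g where "g = (\<lambda>a. \<Sum>i\<in>J. l i * f i a)"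
  \<comment> \<open>The alternative for the pair \<open>g\<close>, \<open>f j\<close> holds because
    \<open>g\<close> is nonpositive on \<open>V\<close> and \<open>f j\<close> is nonpositive off
    \<open>V\<close>.\<close>
  have "\<exists>t. 0 \<le> t \<and> t \<le> 1 \<and> (\<forall>a\<in>U. t * g a + (1 - t) * f j a \<le> 0)"
  proof (rule convexlike_alternative_two)
    fix a b and s :: real
    assume "a \<in> U" "b \<in> U" "0 \<le> s" "s \<le> 1"
    then obtain c where c: "c \<in> U" "\<forall>i\<in>insert j J. f i c = s * f i a + (1 - s) * f i b"
      using insert.prems(1) by blast
    have "g c = (\<Sum>i\<in>J. s * (l i * f i a) + (1 - s) * (l i * f i b))"
      unfolding g_def by (rule sum.cong) (simp_all add: c(2) distrib_left mult_ac)
    also have "\<dots> = s * g a + (1 - s) * g b"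
      by (simp add: g_def sum.distrib sum_distrib_left)
    finally show "\<exists>c\<in>U. g c = s * g a + (1 - s) * g b \<and> f j c = s * f j a + (1 - s) * f j b"
      using c by blast
  next
    fix a assume "a \<in> U"
    then show "g a \<le> 0 \<or> f j a \<le> 0" using l(3) by (force simp: g_def V_def)
  qed
  then obtain t where t: "0 \<le> t" "t \<le> 1" "\<forall>a\<in>U. t * g a + (1 - t) * f j a \<le> 0" by blast
  define l' where "l' = (\<lambda>i. if i = j then 1 - t else t * l i)"
  have l'J: "l' i = t * l i" if "i \<in> J" for i using that insert.hyps by (auto simp: l'_def)
  have "\<forall>i\<in>insert j J. 0 \<le> l' i" using t l by (auto simp: l'_def)
  moreover have "sum l' (insert j J) = 1"
    using insert.hyps l'J l(2) by (simp add: sum_distrib_left[symmetric]) (simp add: l'_def)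
  moreover have "(\<Sum>i\<in>insert j J. l' i * f i a) \<le> 0" if "a \<in> U" for a
  proof -
    have "(\<Sum>i\<in>J. l' i * f i a) = t * g a"
      by (simp add: g_def l'J sum_distrib_left mult.assoc)
    then show ?thesis using t(3) that insert.hyps by (simp add: l'_def add.commute)
  qed
  ultimately show ?case by blast
qed

section \<open>Scalar products with second-stage solutions\<close>

lemma scalar_prod_weighted_sum:
  assumes "\<xi> \<in> carrier_vec n" and "\<And>i. i \<in> {1..q} \<Longrightarrow> z i \<in> carrier_vec n"
  shows "\<xi> \<bullet> weighted_sum n q l z = (\<Sum>i\<in>{1..q}. l i * (\<xi> \<bullet> z i))"
proof -
  have c: "(\<lambda>i. l i \<cdot>\<^sub>v z i) \<in> {1..q} \<rightarrow> carrier_vec n" using assms by auto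
  have "weighted_sum n q l z $ j = (\<Sum>i\<in>{1..q}. l i * z i $ j)" if "j < n" for j
  proof -
    have "(l i \<cdot>\<^sub>v z i) $ j = l i * z i $ j" if "i \<in> {1..q}" for i
      using assms(2)[OF that] \<open>j < n\<close> by simp
    then show ?thesis
      unfolding weighted_sum_def
      by (simp only: index_finsum_vec[OF _ that c] finite_atLeastAtMost cong: sum.cong)
  qed
  moreover have "dim_vec (weighted_sum n q l z) = n"
    using finsum_vec_closed[OF c] by (simp add: weighted_sum_def)
  ultimately have "\<xi> \<bullet> weighted_sum n q l z = (\<Sum>j<n. \<xi> $ j * (\<Sum>i\<in>{1..q}. l i * z i $ j))"
    by (simp add: scalar_prod_def lessThan_atLeast0)
  also have "\<dots> = (\<Sum>i\<in>{1..q}. \<Sum>j<n. l i * (\<xi> $ j * z i $ j))"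
    by (subst sum.swap) (simp add: sum_distrib_left mult_ac)
  also have "\<dots> = (\<Sum>i\<in>{1..q}. l i * (\<xi> \<bullet> z i))"
    using carrier_vecD[OF assms(2)]
    by (intro sum.cong refl) (simp add: scalar_prod_def sum_distrib_left lessThan_atLeast0)
  finally show ?thesis .
qed

lemma nonzero_count_eq_sum:
  assumes "y \<in> binary_vecs n"
  shows "real (nonzero_count y) = (\<Sum>j<n. y $ j)"
proof -
  have y: "dim_vec y = n" "\<And>j. j < n \<Longrightarrow> y $ j = 0 \<or> y $ j = 1"
    using assms by (auto simp: binary_vecs_def)
  have "(\<Sum>j<n. y $ j) = (\<Sum>j<n. if y $ j \<noteq> 0 then 1 else 0)"
    using y by (intro sum.cong) auto
  also have "\<dots> = real (card {j. j < n \<and> y $ j \<noteq> 0})"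
    by (subst sum.inter_filter[symmetric]) auto
  finally show ?thesis using y by (simp add: nonzero_count_def)
qed

lemma scalar_prod_binary_mono:
  assumes "y \<in> binary_vecs n" and "\<And>j. j < n \<Longrightarrow> \<xi> $ j \<le> c * \<zeta> $ j"
  shows "\<xi> \<bullet> y \<le> c * (\<zeta> \<bullet> y)"
proof -
  have y: "dim_vec y = n" "\<And>j. j < n \<Longrightarrow> 0 \<le> y $ j"
    using assms(1) by (force simp: binary_vecs_def)+
  then show ?thesis
    using assms(2) by (auto simp: scalar_prod_def sum_distrib_left mult.assoc[symmetric]
        intro!: sum_mono mult_right_mono)
qed

lemma scalar_prod_binary_bounds:
  assumes y: "y \<in> binary_vecs n"
    and "\<And>j. j < n \<Longrightarrow> m \<le> \<xi> $ j" and "\<And>j. j < n \<Longrightarrow> \<xi> $ j \<le> M"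
  shows "m * real (nonzero_count y) \<le> \<xi> \<bullet> y" and "\<xi> \<bullet> y \<le> M * real (nonzero_count y)"
proof -
  have d: "dim_vec y = n" and y0: "\<And>j. j < n \<Longrightarrow> 0 \<le> y $ j"
    using y by (force simp: binary_vecs_def)+
  show "m * real (nonzero_count y) \<le> \<xi> \<bullet> y" "\<xi> \<bullet> y \<le> M * real (nonzero_count y)"
    unfolding nonzero_count_eq_sum[OF y] sum_distrib_left scalar_prod_def d lessThan_atLeast0
    using assms(2,3) y0 by (auto intro!: sum_mono mult_right_mono)
qed

section \<open>Approximation guarantee of the min-max-min algorithm\<close>

lemma Min_image_le_iff:
  fixes f :: "'i \<Rightarrow> real"
  assumes "finite J" "J \<noteq> {}"
  shows "(MIN i\<in>J. f i) \<le> c \<longleftrightarrow> (\<exists>i\<in>J. f i \<le> c)"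
  using assms by (simp add: Min_le_iff)

text \<open>This is the direction of minimax duality that the approximation bound needs. The
  functions \<open>\<xi> \<bullet> z i - c\<close> are affine in \<open>\<xi>\<close>, so convexity
  of \<open>U\<close> makes them convexlike, and the alternative yields the weights.\<close>

lemma minimax_weights:
  assumes "convex_vecs U" "U \<subseteq> carrier_vec n" "1 \<le> q"
    and z: "\<And>i. i \<in> {1..q} \<Longrightarrow> z i \<in> carrier_vec n"
    and c: "\<And>\<xi>. \<xi> \<in> U \<Longrightarrow> (MIN i\<in>{1..q}. \<xi> \<bullet> z i) \<le> c"
  shows "\<exists>l\<in>convex_weights q. \<forall>\<xi>\<in>U. \<xi> \<bullet> weighted_sum n q l z \<le> c"
proof -
  have "\<exists>l. (\<forall>i\<in>{1..q}. 0 \<le> l i) \<and> sum l {1..q} = 1 \<and>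
      (\<forall>\<xi>\<in>U. (\<Sum>i\<in>{1..q}. l i * (\<xi> \<bullet> z i - c)) \<le> 0)"
  proof (rule convexlike_alternative)
    fix \<xi> \<zeta> and s :: real
    assume h: "\<xi> \<in> U" "\<zeta> \<in> U" "0 \<le> s" "s \<le> 1"
    have "s \<cdot>\<^sub>v \<xi> + (1 - s) \<cdot>\<^sub>v \<zeta> \<in> U" using assms(1) h by (auto simp: convex_vecs_def)
    moreover have "(s \<cdot>\<^sub>v \<xi> + (1 - s) \<cdot>\<^sub>v \<zeta>) \<bullet> z i - c
        = s * (\<xi> \<bullet> z i - c) + (1 - s) * (\<zeta> \<bullet> z i - c)" if "i \<in> {1..q}" for i
    proof -
      have "(s \<cdot>\<^sub>v \<xi> + (1 - s) \<cdot>\<^sub>v \<zeta>) \<bullet> z i = s * (\<xi> \<bullet> z i) + (1 - s) * (\<zeta> \<bullet> z i)"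
        using z[OF that] subsetD[OF assms(2) h(1)] subsetD[OF assms(2) h(2)]
        by (simp add: add_scalar_prod_distrib[of _ n] smult_scalar_prod_distrib[of _ n])
      then show ?thesis by (simp add: algebra_simps)
    qed
    ultimately show "\<exists>\<eta>\<in>U. \<forall>i\<in>{1..q}.
        \<eta> \<bullet> z i - c = s * (\<xi> \<bullet> z i - c) + (1 - s) * (\<zeta> \<bullet> z i - c)" by blast
  next
    fix \<xi> assume "\<xi> \<in> U"
    then show "\<exists>i\<in>{1..q}. \<xi> \<bullet> z i - c \<le> 0"
      using c[of \<xi>] assms(3) by (simp add: Min_image_le_iff)
  qed (use assms(3) in auto)
  then obtain l where l: "\<forall>i\<in>{1..q}. 0 \<le> l i" "sum l {1..q} = 1"
      "\<forall>\<xi>\<in>U. (\<Sum>i\<in>{1..q}. l i * (\<xi> \<bullet> z i - c)) \<le> 0" by blast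
  have "\<xi> \<bullet> weighted_sum n q l z \<le> c" if "\<xi> \<in> U" for \<xi>
  proof -
    have "(\<Sum>i\<in>{1..q}. l i * (\<xi> \<bullet> z i - c)) = \<xi> \<bullet> weighted_sum n q l z - c"
      using that assms(2) z l(2)
      by (subst scalar_prod_weighted_sum)
        (auto simp: right_diff_distrib sum_subtractf sum_distrib_right[symmetric])
    then show ?thesis using bspec[OF l(3) that] by linarith
  qed
  then show ?thesis using l by (auto simp: convex_weights_def)
qed

text \<open>Since the weights sum to one, \<open>u\<close> minus the weighted average equals the
  weighted sum of the gaps \<open>u - v i\<close>. The first \<open>k\<close> gaps are nonpositive;
  each of the other \<open>n - k\<close> terms is at most \<open>D / (k + 1)\<close>.\<close>

lemma sorted_prefix_min_bound:
  fixes l v :: "nat \<Rightarrow> real"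
  assumes k: "1 \<le> k" "k \<le> n"
    and l0: "\<And>i. i \<in> {1..n} \<Longrightarrow> 0 \<le> l i" and l1: "(\<Sum>i\<in>{1..n}. l i) = 1"
    and sorted: "\<And>a b. \<lbrakk>a \<in> {1..n}; b \<in> {1..n}; a \<le> b\<rbrakk> \<Longrightarrow> l b \<le> l a"
    and u: "\<And>i. i \<in> {1..k} \<Longrightarrow> u \<le> v i"
    and D: "\<And>i. i \<in> {1..n} \<Longrightarrow> u - v i \<le> D" "0 \<le> D"
  shows "u \<le> (\<Sum>i\<in>{1..n}. l i * v i) + (real n - real k) / (real k + 1) * D"
proof -
  \<comment> \<open>An index beyond \<open>k\<close> is preceded by at least \<open>k\<close>
    others, so together with its own position there are \<open>k + 1\<close> weights that are no
    smaller, and these sum to at most one.\<close>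
  have small: "l i \<le> 1 / (real k + 1)" if i: "i \<in> {Suc k..n}" for i
  proof -
    have "(real k + 1) * l i = (\<Sum>j\<in>{1..Suc k}. l i)" by simp
    also have "\<dots> \<le> (\<Sum>j\<in>{1..Suc k}. l j)"
      using i sorted by (intro sum_mono) auto
    also have "\<dots> \<le> (\<Sum>j\<in>{1..n}. l j)"
      using i l0 by (intro sum_mono2) auto
    finally show ?thesis using l1 by (simp add: field_simps)
  qed
  have split: "{1..n} = {1..k} \<union> {Suc k..n}" using k by auto
  have "u - (\<Sum>i\<in>{1..n}. l i * v i) = (\<Sum>i\<in>{1..n}. l i * (u - v i))"
    using l1 by (simp add: right_diff_distrib sum_subtractf sum_distrib_right[symmetric])
  also have "\<dots> = (\<Sum>i\<in>{1..k}. l i * (u - v i)) + (\<Sum>i\<in>{Suc k..n}. l i * (u - v i))"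
    unfolding split by (intro sum.union_disjoint) auto
  also have "(\<Sum>i\<in>{1..k}. l i * (u - v i)) \<le> 0"
    using u l0 k by (intro sum_nonpos mult_nonneg_nonpos) auto
  also have "(\<Sum>i\<in>{Suc k..n}. l i * (u - v i)) \<le> (\<Sum>i\<in>{Suc k..n}. 1 / (real k + 1) * D)"
  proof (intro sum_mono)
    fix i assume i: "i \<in> {Suc k..n}"
    then have "l i * (u - v i) \<le> l i * D" using l0 D(1) k by (intro mult_left_mono) auto
    also have "\<dots> \<le> 1 / (real k + 1) * D" using small[OF i] D(2) by (intro mult_right_mono)
    finally show "l i * (u - v i) \<le> 1 / (real k + 1) * D" .
  qed
  also have "\<dots> = (real n - real k) / (real k + 1) * D"
    using k by (simp add: of_nat_diff)
  finally show ?thesis by simp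
qed

text \<open>Any \<open>y\<close> with worst-case cost at most \<open>c\<close> may serve as the
  benchmark; the main proof inserts a scenario solution. The bounds \<open>lo\<close> and
  \<open>hi\<close> turn the additive loss from dropping solutions into a relative one.\<close>

lemma min_max_min_approximation:
  assumes U: "convex_vecs U" "U \<subseteq> carrier_vec n" "U \<noteq> {}"
    and k: "1 \<le> k" "k \<le> n" and Z: "Z \<subseteq> carrier_vec n"
    and out: "min_max_min_output n Z U k w"
    and y: "y \<in> Z" and c: "\<And>\<xi>. \<xi> \<in> U \<Longrightarrow> \<xi> \<bullet> y \<le> c"
    and lo: "0 < lo" "\<And>\<xi> y. \<lbrakk>\<xi> \<in> U; y \<in> Z\<rbrakk> \<Longrightarrow> lo \<le> \<xi> \<bullet> y"
    and hi: "\<And>\<xi> y. \<lbrakk>\<xi> \<in> U; y \<in> Z\<rbrakk> \<Longrightarrow> \<xi> \<bullet> y \<le> hi"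
  shows "max_min_value U k w \<le> (1 + hi / lo * ((real n - real k) / (real k + 1))) * c"
proof -
  obtain z l \<sigma> where
    z: "is_arg_min (max_min_value U n) (\<lambda>z. z \<in> {1..n} \<rightarrow> Z) z" and
    l: "is_arg_min (\<lambda>l. SUP \<xi>\<in>U. \<xi> \<bullet> weighted_sum n n l z) (\<lambda>l. l \<in> convex_weights n) l" and
    \<sigma>: "bij_betw \<sigma> {1..n} {1..n}" and
    sorted: "\<forall>a\<in>{1..n}. \<forall>b\<in>{1..n}. a \<le> b \<longrightarrow> l (\<sigma> b) \<le> l (\<sigma> a)" and
    w: "\<forall>i\<in>{1..k}. w i = z (\<sigma> i)"
    using out unfolding min_max_min_output_def by blast
  have n: "1 \<le> n" using k by simp
  have zZ: "z i \<in> Z" if "i \<in> {1..n}" for i using z that by (auto simp: is_arg_min_def)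
  have zc: "z i \<in> carrier_vec n" if "i \<in> {1..n}" for i using zZ[OF that] Z by auto
  have \<sigma>_in: "\<sigma> i \<in> {1..n}" if "i \<in> {1..n}" for i using \<sigma> that by (auto simp: bij_betw_def)
  have lw: "l \<in> convex_weights n" using l by (simp add: is_arg_min_def)
  define opt where "opt = max_min_value U n z"
  \<comment> \<open>Besides bounding costs, \<open>hi\<close> makes the values bounded above, so
    that the \<open>SUP\<close> is a genuine upper bound; \<open>bd\<close> does the same for the
    weighted sums.\<close>
  have Min_le_hi: "(MIN i\<in>{1..n}. \<xi> \<bullet> z i) \<le> hi" if "\<xi> \<in> U" for \<xi>
    using that zZ[of 1] hi n by (subst Min_image_le_iff) (auto intro!: bexI[of _ 1])
  have Min_le_opt: "(MIN i\<in>{1..n}. \<xi> \<bullet> z i) \<le> opt" if "\<xi> \<in> U" for \<xi>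
    unfolding opt_def max_min_value_def using that Min_le_hi
    by (intro cSUP_upper bdd_aboveI2) auto
  have opt_ge: "lo \<le> opt"
  proof -
    obtain \<xi> where \<xi>: "\<xi> \<in> U" using U by blast
    have "lo \<le> (MIN i\<in>{1..n}. \<xi> \<bullet> z i)" using n lo(2)[OF \<xi> zZ] by (subst Min_ge_iff) auto
    also have "\<dots> \<le> opt" using Min_le_opt[OF \<xi>] .
    finally show ?thesis .
  qed
  \<comment> \<open>The constant tuple of copies of \<open>y\<close> competes in the first
    minimization of the algorithm.\<close>
  have opt_le: "opt \<le> c"
  proof -
    have "opt \<le> max_min_value U n (\<lambda>_. y)"
      using z y unfolding opt_def is_arg_min_linorder by auto
    also have "\<dots> = (SUP \<xi>\<in>U. \<xi> \<bullet> y)" using n by (simp add: max_min_value_def)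
    also have "\<dots> \<le> c" using U c by (intro cSUP_least) auto
    finally show ?thesis .
  qed
  have hi0: "lo \<le> hi"
  proof -
    obtain \<xi> where "\<xi> \<in> U" using U by blast
    then show ?thesis using lo(2)[of \<xi> y] hi[of \<xi> y] y by linarith
  qed
  have weighted: "(\<Sum>i\<in>{1..n}. l i * (\<xi> \<bullet> z i)) \<le> opt" if \<xi>: "\<xi> \<in> U" for \<xi>
  proof -
    have eq: "\<zeta> \<bullet> weighted_sum n n l z = (\<Sum>i\<in>{1..n}. l i * (\<zeta> \<bullet> z i))" if "\<zeta> \<in> U" for \<zeta>
      using that U(2) zc by (intro scalar_prod_weighted_sum) auto
    have bd: "\<zeta> \<bullet> weighted_sum n n l z \<le> hi" if "\<zeta> \<in> U" for \<zeta>
    proof -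
      have "(\<Sum>i\<in>{1..n}. l i * (\<zeta> \<bullet> z i)) \<le> (\<Sum>i\<in>{1..n}. l i * hi)"
        using lw hi zZ that by (intro sum_mono mult_left_mono) (auto simp: convex_weights_def)
      also have "\<dots> = hi" using lw by (simp add: convex_weights_def sum_distrib_right[symmetric])
      finally show ?thesis by (simp add: eq that)
    qed
    \<comment> \<open>Duality gives some weights \<open>l'\<close> with value at most
      \<open>opt\<close>; the weights \<open>l\<close> computed by the algorithm are optimal and
      hence no worse.\<close>
    obtain l' where l': "l' \<in> convex_weights n" "\<forall>\<xi>\<in>U. \<xi> \<bullet> weighted_sum n n l' z \<le> opt"
      using minimax_weights[OF U(1,2) n zc Min_le_opt] by blast
    have "\<xi> \<bullet> weighted_sum n n l z \<le> (SUP \<xi>\<in>U. \<xi> \<bullet> weighted_sum n n l z)"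
      using \<xi> bd by (intro cSUP_upper bdd_aboveI2) auto
    also have "\<dots> \<le> (SUP \<xi>\<in>U. \<xi> \<bullet> weighted_sum n n l' z)"
      using l l'(1) unfolding is_arg_min_linorder by blast
    also have "\<dots> \<le> opt" using U(3) l'(2) by (intro cSUP_least) auto
    finally show ?thesis by (simp add: eq \<xi>)
  qed
  have key: "(MIN i\<in>{1..k}. \<xi> \<bullet> w i) \<le> opt + (real n - real k) / (real k + 1) * (hi / lo * opt)"
    if \<xi>: "\<xi> \<in> U" for \<xi>
  proof -
    let ?u = "MIN i\<in>{1..k}. \<xi> \<bullet> w i"
    have u: "?u \<le> \<xi> \<bullet> z (\<sigma> i)" if "i \<in> {1..k}" for i
      using that w by (intro Min_le) (auto intro!: image_eqI)
    \<comment> \<open>As \<open>lo \<le> opt\<close>, the absolute bound \<open>hi\<close> is at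
      most \<open>hi / lo * opt\<close>. Costs are positive, so this also bounds every gap and can
      serve as \<open>D\<close>.\<close>
    have "hi = hi / lo * lo" using lo(1) by simp
    also have "\<dots> \<le> hi / lo * opt" using opt_ge lo(1) hi0 by (intro mult_left_mono) auto
    finally have hi_le: "hi \<le> hi / lo * opt" .
    have "?u \<le> \<xi> \<bullet> z (\<sigma> 1)" using u k by auto
    also have "\<dots> \<le> hi" using \<xi> hi zZ \<sigma>_in n by auto
    finally have u_hi: "?u \<le> hi" .
    have "?u \<le> (\<Sum>i\<in>{1..n}. l (\<sigma> i) * (\<xi> \<bullet> z (\<sigma> i)))
        + (real n - real k) / (real k + 1) * (hi / lo * opt)"
    proof (rule sorted_prefix_min_bound[OF k])
      show "(\<Sum>i\<in>{1..n}. l (\<sigma> i)) = 1"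
        using lw sum.reindex_bij_betw[OF \<sigma>, of l] by (simp add: convex_weights_def)
      fix i assume i: "i \<in> {1..n}"
      show "0 \<le> l (\<sigma> i)" using lw \<sigma>_in[OF i] by (auto simp: convex_weights_def)
      show "?u - \<xi> \<bullet> z (\<sigma> i) \<le> hi / lo * opt"
        using u_hi hi_le lo(1) lo(2)[OF \<xi> zZ[OF \<sigma>_in[OF i]]] by linarith
    qed (use u sorted hi_le hi0 lo(1) in auto)
    also have "(\<Sum>i\<in>{1..n}. l (\<sigma> i) * (\<xi> \<bullet> z (\<sigma> i))) = (\<Sum>i\<in>{1..n}. l i * (\<xi> \<bullet> z i))"
      using sum.reindex_bij_betw[OF \<sigma>, of "\<lambda>i. l i * (\<xi> \<bullet> z i)"] .
    also have "\<dots> \<le> opt" using weighted[OF \<xi>] .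
    finally show ?thesis by simp
  qed
  have "max_min_value U k w \<le> opt + (real n - real k) / (real k + 1) * (hi / lo * opt)"
    unfolding max_min_value_def using U(3) key by (intro cSUP_least) auto
  also have "\<dots> = (1 + hi / lo * ((real n - real k) / (real k + 1))) * opt"
    by (subst distrib_right) (simp only: mult_1_left mult_ac)
  also have "\<dots> \<le> (1 + hi / lo * ((real n - real k) / (real k + 1))) * c"
    using opt_le hi0 lo(1) k by (intro mult_left_mono) auto
  finally show ?thesis .
qed

section \<open>The scenario problem\<close>

text \<open>An optimal adaptable solution has, for each scenario, one of its \<open>k\<close>
  second-stage solutions of total cost at most \<open>adapt I k\<close>. Assigning that solution to
  the scenario, with repetitions allowed, gives a feasible point of the scenario problem.\<close>

lemma scenario_value_le_adapt:
  assumes att: "\<exists>p. is_arg_min (worst_case_cost I k) (\<lambda>p. p \<in> feasible I k) p"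
    and k: "1 \<le> k"
    and hi: "\<And>x y \<xi>. \<lbrakk>x \<in> first_stage I; y \<in> second_stage I x; \<xi> \<in> uncertainty I\<rbrakk> \<Longrightarrow> \<xi> \<bullet> y \<le> hi"
    and dims: "\<And>x. x \<in> first_stage I \<Longrightarrow> second_stage I x \<subseteq> carrier_vec n"
      "uncertainty I \<subseteq> carrier_vec n"
    and \<xi>s: "\<xi>s \<in> {1..t} \<rightarrow> uncertainty I"
    and opt: "is_arg_min (\<lambda>(x, y, \<mu>). first_cost I \<bullet> x + \<mu>) (\<lambda>s. s \<in> scenario_feasible I t \<xi>s)
      (xh, yh, \<mu>h)"
  shows "first_cost I \<bullet> xh + \<mu>h \<le> adapt I k"
proof -
  obtain x y where p: "is_arg_min (worst_case_cost I k) (\<lambda>p. p \<in> feasible I k) (x, y)"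
    using att by auto
  have xy: "x \<in> first_stage I" "y \<in> {1..k} \<rightarrow> second_stage I x"
    using p by (auto simp: is_arg_min_def feasible_def)
  \<comment> \<open>Attainment of the minimum turns the \<open>INF\<close> into the value of a
    concrete solution.\<close>
  have adapt: "adapt I k = worst_case_cost I k (x, y)"
    unfolding adapt_def using p
    by (intro cInf_eq_minimum) (auto simp: is_arg_min_linorder)
  have y1: "y 1 \<in> second_stage I x" using xy k by auto
  let ?d = "first_cost I \<bullet> x"
  have "\<exists>i\<in>{1..k}. y i \<bullet> \<xi>s j \<le> adapt I k - ?d" if j: "j \<in> {1..t}" for j
  proof -
    have \<xi>: "\<xi>s j \<in> uncertainty I" using \<xi>s j by auto
    have bd: "(MIN i\<in>{1..k}. ?d + \<zeta> \<bullet> y i) \<le> ?d + hi" if "\<zeta> \<in> uncertainty I" for \<zeta>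
      using k hi[OF xy(1) y1 that] by (subst Min_image_le_iff) (auto intro!: bexI[of _ 1])
    have "(MIN i\<in>{1..k}. ?d + \<xi>s j \<bullet> y i) \<le> adapt I k"
      unfolding adapt worst_case_cost_def prod.case
      using \<xi> bd by (intro cSUP_upper bdd_aboveI2) auto
    then obtain i where i: "i \<in> {1..k}" "?d + \<xi>s j \<bullet> y i \<le> adapt I k"
      using k by (subst (asm) Min_image_le_iff) auto
    have "y i \<in> carrier_vec n" "\<xi>s j \<in> carrier_vec n" using i xy dims \<xi> by blast+
    then have "\<xi>s j \<bullet> y i = y i \<bullet> \<xi>s j" by (rule comm_scalar_prod[rotated])
    with i show ?thesis by (intro bexI[of _ i]) auto
  qed
  then obtain s where s: "\<And>j. j \<in> {1..t} \<Longrightarrow> s j \<in> {1..k} \<and> y (s j) \<bullet> \<xi>s j \<le> adapt I k - ?d"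
    by metis
  have le: "first_cost I \<bullet> xh + \<mu>h \<le> first_cost I \<bullet> x' + \<mu>"
    if "(x', y', \<mu>) \<in> scenario_feasible I t \<xi>s" for x' y' \<mu>
    using opt that by (auto simp: is_arg_min_linorder)
  \<comment> \<open>The choice of \<open>\<mu>\<close> as \<open>adapt I k\<close> minus the
    first-stage cost makes the scenario objective equal to \<open>adapt I k\<close>.\<close>
  have "(x, \<lambda>j. y (s j), adapt I k - ?d) \<in> scenario_feasible I t \<xi>s"
    using xy s by (fastforce simp: scenario_feasible_def)
  from le[OF this] show ?thesis by simp
qed

section \<open>Combining the two bounds into the approximation factor\<close>

theorem theorem25:
  fixes \<C> :: "kadapt_instance set" and I :: kadapt_instance
    and pl pu :: "nat \<Rightarrow> real" and m M \<alpha> Mt :: real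
    and n k t :: nat and ul uu xh :: "real vec" and yb :: "nat \<Rightarrow> real vec"
  assumes "problem_class \<C>" and "cardinality_bounds \<C> pl pu"
    and "I \<in> \<C>" and "dim2 I = n" and "0 < pl n"
    and "cost_bounds I m M"
    and "\<forall>x\<in>first_stage I. 0 \<le> first_cost I \<bullet> x"
    and "1 \<le> k" and "k \<le> n" and "k \<le> t"
    and "ul \<in> nonneg_vecs n" and "uu \<in> nonneg_vecs n" and "\<forall>j<n. 0 < ul $ j"
    and "uncertainty I \<subseteq> {ul..uu}"
    and "extrema_attained I k"
    and "scenario_algorithm_output I k t xh yb"
    and "\<alpha> = (MAX j\<in>{..<n}. uu $ j / ul $ j)"
    and "Mt = M / m * (pu n / pl n)"
  shows "approx_adapt I k xh yb
           \<le> \<alpha> * (1 + Mt * ((real n - real k) / (real k + 1))) * adapt I k"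
proof -
  let ?U = "uncertainty I" and ?d = "first_cost I \<bullet> xh"
  define F where "F = 1 + Mt * ((real n - real k) / (real k + 1))"
  have val: "valid_instance I" using assms(1,3) by (auto simp: problem_class_def)
  have U: "?U \<noteq> {}" "?U \<subseteq> carrier_vec n" "convex_vecs ?U"
    using val assms(4) by (auto simp: valid_instance_def nonneg_vecs_def)
  have bin: "second_stage I x \<subseteq> binary_vecs n" if "x \<in> first_stage I" for x
    using val that assms(4) by (auto simp: valid_instance_def)
  have dims: "second_stage I x \<subseteq> carrier_vec n" if "x \<in> first_stage I" for x
    using bin[OF that] by (auto simp: binary_vecs_def)
  have mM: "0 < m" "m \<le> M" and
    cb: "\<And>\<xi> j. \<lbrakk>\<xi> \<in> ?U; j < n\<rbrakk> \<Longrightarrow> m \<le> \<xi> $ j \<and> \<xi> $ j \<le> M"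
    using assms(4,6) by (auto simp: cost_bounds_def)
  have card: "pl n \<le> real (nonzero_count y)" "real (nonzero_count y) \<le> pu n"
    if "x \<in> first_stage I" "y \<in> second_stage I x" for x y
    using assms(2,3,4) that by (auto simp: cardinality_bounds_def)
  \<comment> \<open>A cost adds up one entry of \<open>\<xi>\<close> per nonzero entry of
    \<open>y\<close>. The quotient of the bounds \<open>M * pu n\<close> and \<open>m * pl n\<close>
    is exactly \<open>Mt\<close>.\<close>
  have lo: "m * pl n \<le> \<xi> \<bullet> y"
    if h: "x \<in> first_stage I" "y \<in> second_stage I x" "\<xi> \<in> ?U" for x y \<xi>
  proof -
    have "m * pl n \<le> m * real (nonzero_count y)" using card[OF h(1,2)] mM by auto
    also have "\<dots> \<le> \<xi> \<bullet> y"
      using h bin cb by (intro scalar_prod_binary_bounds(1)[where M = M and n = n]) auto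
    finally show ?thesis .
  qed
  have hi: "\<xi> \<bullet> y \<le> M * pu n"
    if h: "x \<in> first_stage I" "y \<in> second_stage I x" "\<xi> \<in> ?U" for x y \<xi>
  proof -
    have "\<xi> \<bullet> y \<le> M * real (nonzero_count y)"
      using h bin cb by (intro scalar_prod_binary_bounds(2)[where m = m and n = n]) auto
    also have "\<dots> \<le> M * pu n" using card[OF h(1,2)] mM by auto
    finally show ?thesis .
  qed
  obtain \<xi>s yh \<mu>h where \<xi>s: "\<xi>s \<in> {1..t} \<rightarrow> ?U" and
    opt: "is_arg_min (\<lambda>(x, y, \<mu>). first_cost I \<bullet> x + \<mu>) (\<lambda>s. s \<in> scenario_feasible I t \<xi>s)
      (xh, yh, \<mu>h)" and
    out: "min_max_min_output n (second_stage I xh) ?U k yb"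
    using assms(4,16) by (auto simp: scenario_algorithm_output_def)
  \<comment> \<open>A single scenario suffices for the comparison; the first one exists because
    \<open>1 \<le> k \<le> t\<close>.\<close>
  have t1: "1 \<in> {1..t}" using assms(8,10) by auto
  have feas: "xh \<in> first_stage I" "yh 1 \<in> second_stage I xh" "yh 1 \<bullet> \<xi>s 1 \<le> \<mu>h"
    using opt t1 by (auto simp: is_arg_min_def scenario_feasible_def)
  have \<xi>1: "\<xi>s 1 \<in> ?U" using \<xi>s t1 by auto
  have box: "ul $ j \<le> \<xi> $ j" "\<xi> $ j \<le> uu $ j" if "\<xi> \<in> ?U" "j < n" for \<xi> j
  proof -
    have "dim_vec uu = n" "dim_vec \<xi> = n"
      using assms(12) subsetD[OF U(2) that(1)] by (auto simp: nonneg_vecs_def)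
    moreover have "ul \<le> \<xi>" "\<xi> \<le> uu" using subsetD[OF assms(14) that(1)] by auto
    ultimately show "ul $ j \<le> \<xi> $ j" "\<xi> $ j \<le> uu $ j"
      using that(2) by (auto simp: less_eq_vec_def)
  qed
  have ratio: "uu $ j \<le> \<alpha> * ul $ j" if "j < n" for j
  proof -
    have "uu $ j / ul $ j \<le> \<alpha>" unfolding assms(17) using that by (intro Max_ge) auto
    then show ?thesis using assms(13) that by (simp add: pos_divide_le_eq)
  qed
  have \<alpha>1: "1 \<le> \<alpha>"
  proof -
    have "0 < n" using assms(8,9) by simp
    then have "ul $ 0 \<le> \<alpha> * ul $ 0" "0 < ul $ 0"
      using box[OF \<xi>1, of 0] ratio[of 0] assms(13) by fastforce+
    then show ?thesis by simp
  qed
  \<comment> \<open>Componentwise,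
    \<open>\<xi> \<le> uu \<le> \<alpha> * ul \<le> \<alpha> * \<xi>s 1\<close>, and
    \<open>yh 1\<close> costs at most \<open>\<mu>h\<close> in scenario
    \<open>\<xi>s 1\<close>.\<close>
  have scale: "\<xi> \<bullet> yh 1 \<le> \<alpha> * \<mu>h" if \<xi>: "\<xi> \<in> ?U" for \<xi>
  proof -
    have "\<xi> \<bullet> yh 1 \<le> \<alpha> * (\<xi>s 1 \<bullet> yh 1)"
    proof (rule scalar_prod_binary_mono)
      fix j assume j: "j < n"
      have "\<alpha> * ul $ j \<le> \<alpha> * \<xi>s 1 $ j"
        using box(1)[OF \<xi>1 j] \<alpha>1 by (intro mult_left_mono) auto
      then show "\<xi> $ j \<le> \<alpha> * \<xi>s 1 $ j" using box(2)[OF \<xi> j] ratio[OF j] by linarith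
    qed (use feas bin in auto)
    also have "\<xi>s 1 \<bullet> yh 1 = yh 1 \<bullet> \<xi>s 1"
      using \<xi>1 U(2) feas dims by (intro comm_scalar_prod[of _ n]) auto
    also have "\<alpha> * \<dots> \<le> \<alpha> * \<mu>h" using feas(3) \<alpha>1 by (intro mult_left_mono) auto
    finally show ?thesis .
  qed
  have Mt: "Mt = M * pu n / (m * pl n)" using assms(18) by simp
  \<comment> \<open>The benchmark is \<open>yh 1\<close>, with worst-case cost bounded by
    \<open>\<alpha> * \<mu>h\<close>.\<close>
  have "max_min_value ?U k yb \<le> F * (\<alpha> * \<mu>h)"
    unfolding F_def Mt using feas(1,2) lo hi scale mM assms(5,8,9)
    by (intro min_max_min_approximation[OF U(3,2,1) _ _ dims[OF feas(1)] out feas(2)]) auto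
  moreover have pu0: "0 \<le> pu n" using card[OF feas(1,2)] assms(5) by linarith
  moreover have F1: "1 \<le> F"
    using pu0 mM assms(5,9) by (auto simp: F_def Mt)
  \<comment> \<open>The first-stage cost carries no factor in the objective; being nonnegative, it
    may be inflated by \<open>F * \<alpha> \<ge> 1\<close> to match the second-stage bound.\<close>
  moreover have "?d \<le> F * \<alpha> * ?d"
  proof -
    have "1 * 1 \<le> F * \<alpha>" using F1 \<alpha>1 by (intro mult_mono) auto
    then show ?thesis using assms(7) feas(1) mult_right_mono[of 1 "F * \<alpha>" ?d] by auto
  qed
  ultimately have "approx_adapt I k xh yb \<le> \<alpha> * F * (?d + \<mu>h)"
    by (simp add: approx_adapt_def algebra_simps)
  also have "\<dots> \<le> \<alpha> * F * adapt I k"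
  proof (intro mult_left_mono)
    show "?d + \<mu>h \<le> adapt I k"
      using assms(8,15) hi dims U(2) \<xi>s opt
      by (intro scenario_value_le_adapt[where n = n]) (auto simp: extrema_attained_def)
    show "0 \<le> \<alpha> * F" using \<alpha>1 F1 by auto
  qed
  finally show ?thesis by (simp only: F_def)
qed

end
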